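(* Let $T>0$ and let $S=(S_t)_{t\in[0,T]}$ be a nonnegative càdlàg process satisfying a finite dimensional co-monotony principle. Then, for every strike price $K>0$ and every barrier $L\in(0,S_0)$, $$\mathrm{Call}_{D\&In}(K,L,T)\le\mathrm{Call}(K,T)\,\mathbb{P}({}_*S_T\le L).$$
   Context: ${}_*S_T=\inf_{s\in[0,T]}S_s$; $S_0$ is the initial asset price; $u_+=\max(u,0)$. $\mathrm{Call}(K,T)=\mathbb{E}\,(S_T-K)_+$ is the vanilla Call premium and $\mathrm{Call}_{D\&In}(K,L,T)=\mathbb{E}\big((S_T-K)_+\mathbf{1}_{\{{}_*S_T\le L\}}\big)$ is the Down-and-In Call premium (interest rates are zero). Two Borel functions $\Phi,\Psi:\mathbb{R}^n\to\mathbb{R}$ are componentwise co-monotone if they are both non-decreasing in each variable or both non-increasing in each variable. $S$ satisfies a finite dimensional co-monotony principle if, for every $n\ge1$ and all $0\le t_1<\cdots<t_n\le T$, the vector $Y=(S_{t_k})_{1\le k\le n}$ satisfies $\mathbb{E}\,\Phi(Y)\Psi(Y)\ge\mathbb{E}\,\Phi(Y)\,\mathbb{E}\,\Psi(Y)$ for every pair of Borel componentwise co-monotone functions with $\Phi(Y),\Psi(Y),\Phi(Y)\Psi(Y)\in L^1(\mathbb{P})$. *)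

theory Defs
  imports "HOL-Probability.Probability"
begin

text \<open>
  Since the dimension n varies inside the definitions, Borel functions on R^n are functions on
  the product space \<open>\<Pi>\<^sub>M i\<in>{1..n}. borel\<close>, whose sigma-algebra is the
  Borel sigma-algebra of R^n.
\<close>

definition euclid :: "nat \<Rightarrow> (nat \<Rightarrow> real) measure" where
  "euclid n = (\<Pi>\<^sub>M i\<in>{1..n}. borel)"

definition componentwise_nondecreasing :: "nat \<Rightarrow> ((nat \<Rightarrow> real) \<Rightarrow> real) \<Rightarrow> bool" where
  "componentwise_nondecreasing n f \<longleftrightarrow>
     (\<forall>x\<in>space (euclid n). \<forall>i\<in>{1..n}. mono (\<lambda>u. f (x(i := u))))"

definition componentwise_nonincreasing :: "nat \<Rightarrow> ((nat \<Rightarrow> real) \<Rightarrow> real) \<Rightarrow> bool" where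
  "componentwise_nonincreasing n f \<longleftrightarrow>
     (\<forall>x\<in>space (euclid n). \<forall>i\<in>{1..n}. antimono (\<lambda>u. f (x(i := u))))"

definition componentwise_comonotone ::
  "nat \<Rightarrow> ((nat \<Rightarrow> real) \<Rightarrow> real) \<Rightarrow> ((nat \<Rightarrow> real) \<Rightarrow> real) \<Rightarrow> bool" where
  "componentwise_comonotone n \<Phi> \<Psi> \<longleftrightarrow>
     (componentwise_nondecreasing n \<Phi> \<and> componentwise_nondecreasing n \<Psi>) \<or>
     (componentwise_nonincreasing n \<Phi> \<and> componentwise_nonincreasing n \<Psi>)"

definition comonotony_principle :: "'a measure \<Rightarrow> nat \<Rightarrow> ('a \<Rightarrow> nat \<Rightarrow> real) \<Rightarrow> bool" where
  "comonotony_principle M n Y \<longleftrightarrow>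
     (\<forall>\<Phi>\<in>borel_measurable (euclid n). \<forall>\<Psi>\<in>borel_measurable (euclid n).
        componentwise_comonotone n \<Phi> \<Psi> \<longrightarrow>
        integrable M (\<lambda>\<omega>. \<Phi> (Y \<omega>)) \<longrightarrow>
        integrable M (\<lambda>\<omega>. \<Psi> (Y \<omega>)) \<longrightarrow>
        integrable M (\<lambda>\<omega>. \<Phi> (Y \<omega>) * \<Psi> (Y \<omega>)) \<longrightarrow>
        (\<integral>\<omega>. \<Phi> (Y \<omega>) * \<Psi> (Y \<omega>) \<partial>M)
          \<ge> (\<integral>\<omega>. \<Phi> (Y \<omega>) \<partial>M) * (\<integral>\<omega>. \<Psi> (Y \<omega>) \<partial>M))"

definition finite_dim_comonotony_principle ::
  "'a measure \<Rightarrow> real \<Rightarrow> (real \<Rightarrow> 'a \<Rightarrow> real) \<Rightarrow> bool" where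
  "finite_dim_comonotony_principle M T S \<longleftrightarrow>
     (\<forall>n\<ge>1. \<forall>t. strict_mono_on {1..n} t \<and> t ` {1..n} \<subseteq> {0..T} \<longrightarrow>
        comonotony_principle M n (\<lambda>\<omega>. \<lambda>k\<in>{1..n}. S (t k) \<omega>))"

definition cadlag_on :: "real \<Rightarrow> (real \<Rightarrow> real) \<Rightarrow> bool" where
  "cadlag_on T x \<longleftrightarrow>
     (\<forall>t\<in>{0..<T}. (x \<longlongrightarrow> x t) (at_right t)) \<and>
     (\<forall>t\<in>{0<..T}. \<exists>l. (x \<longlongrightarrow> l) (at_left t))"

text \<open>Only the times in \<open>{0..T}\<close> matter; \<open>S\<close> is arbitrary elsewhere.\<close>

definition cadlag_process :: "'a measure \<Rightarrow> real \<Rightarrow> (real \<Rightarrow> 'a \<Rightarrow> real) \<Rightarrow> bool" where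
  "cadlag_process M T S \<longleftrightarrow>
     (\<forall>t\<in>{0..T}. S t \<in> borel_measurable M) \<and>
     (\<forall>\<omega>\<in>space M. cadlag_on T (\<lambda>t. S t \<omega>))"

definition running_inf :: "real \<Rightarrow> (real \<Rightarrow> 'a \<Rightarrow> real) \<Rightarrow> 'a \<Rightarrow> real" where
  "running_inf T S \<omega> = (INF s\<in>{0..T}. S s \<omega>)"

text \<open>
  No integrability of the terminal price is assumed, so premiums are expectations of
  nonnegative payoffs with values in \<open>[0, \<infinity>]\<close>.
\<close>

definition call_premium :: "'a measure \<Rightarrow> (real \<Rightarrow> 'a \<Rightarrow> real) \<Rightarrow> real \<Rightarrow> real \<Rightarrow> ennreal" where
  "call_premium M S K T = (\<integral>\<^sup>+\<omega>. ennreal (max (S T \<omega> - K) 0) \<partial>M)"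

definition call_down_in_premium ::
  "'a measure \<Rightarrow> (real \<Rightarrow> 'a \<Rightarrow> real) \<Rightarrow> real \<Rightarrow> real \<Rightarrow> real \<Rightarrow> ennreal" where
  "call_down_in_premium M S K L T =
     (\<integral>\<^sup>+\<omega>. ennreal (max (S T \<omega> - K) 0) * indicator {\<omega>. running_inf T S \<omega> \<le> L} \<omega> \<partial>M)"

end

theory Submission
  imports Defs
begin

text \<open>
  On a finite grid of times, the truncated payoff \<open>min (max (S\<^sub>T - K) 0) N\<close> and the
  indicator of ``no grid value falls below \<open>c\<close>'' are both nondecreasing, so the
  co-monotony principle makes the payoff negatively correlated with the complementary event. This
  inequality compares two finite measures and hence survives monotone limits of events: refining
  dyadic grids reach the event that the running infimum is below \<open>c\<close> (by right-continuity), and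
  letting \<open>c\<close> decrease to \<open>L\<close> reaches the barrier event. Finally \<open>N\<close> tends to infinity.
\<close>

text \<open>Truncating at \<open>N\<close> bounds everything in sight, so the integrability
  hypotheses of the co-monotony principle hold although \<open>S T\<close> itself may fail to be
  integrable. Reading the payoff at the last grid time makes it a function of the same vector as the
  event.\<close>

lemma grid_truncated_call_barrier:
  fixes S :: "real \<Rightarrow> 'a \<Rightarrow> real" and t :: "nat \<Rightarrow> real" and K N c :: real
  assumes "prob_space M"
    and meas: "\<And>s. s \<in> {0..T} \<Longrightarrow> S s \<in> borel_measurable M"
    and princ: "finite_dim_comonotony_principle M T S"
    and n: "n \<ge> 1" and t: "strict_mono_on {1..n} t" "t ` {1..n} \<subseteq> {0..T}"
    and N: "N \<ge> 0"
  defines "X \<equiv> \<lambda>\<omega>. ennreal (min (max (S (t n) \<omega> - K) 0) N)"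
    and "A \<equiv> {\<omega>\<in>space M. \<exists>k\<in>{1..n}. S (t k) \<omega> < c}"
  shows "(\<integral>\<^sup>+\<omega>. X \<omega> * indicator A \<omega> \<partial>M) \<le> (\<integral>\<^sup>+\<omega>. X \<omega> \<partial>M) * emeasure M A"
proof -
  interpret prob_space M by fact
  define Y where "Y = (\<lambda>\<omega>. \<lambda>k\<in>{1..n}. S (t k) \<omega>)"
  define \<Phi> where "\<Phi> = (\<lambda>y::nat \<Rightarrow> real. min (max (y n - K) 0) N)"
  \<comment> \<open>The indicator of \<open>A\<close> is nonincreasing in the grid values; its
    complement is taken so that both functions are nondecreasing.\<close>
  define \<Psi> where "\<Psi> = (\<lambda>y::nat \<Rightarrow> real. if \<forall>k\<in>{1..n}. c \<le> y k then 1 else 0 :: real)"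
  have S_meas [measurable]: "S (t k) \<in> borel_measurable M" if "k \<in> {1..n}" for k
    using that t(2) meas by blast
  have n_in: "n \<in> {1..n}" using n by simp
  have comp [measurable]: "(\<lambda>y. y k) \<in> borel_measurable (euclid n)" if "k \<in> {1..n}" for k
    unfolding euclid_def using that by (rule measurable_component_singleton)
  note [measurable] = comp[OF n_in] S_meas[OF n_in]
  have \<Phi>_meas: "\<Phi> \<in> borel_measurable (euclid n)"
    unfolding \<Phi>_def by measurable
  have \<Psi>_meas: "\<Psi> \<in> borel_measurable (euclid n)"
    unfolding \<Psi>_def by measurable
  have A_meas [measurable]: "A \<in> sets M"
    unfolding A_def by measurable
  have "componentwise_nondecreasing n \<Phi>"
    unfolding componentwise_nondecreasing_def \<Phi>_def by (auto intro!: monoI)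
  moreover have "componentwise_nondecreasing n \<Psi>"
    unfolding componentwise_nondecreasing_def \<Psi>_def
    by (auto intro!: monoI)
  ultimately have comono: "componentwise_comonotone n \<Phi> \<Psi>"
    by (simp add: componentwise_comonotone_def)
  define x where "x = (\<lambda>\<omega>. min (max (S (t n) \<omega> - K) 0) N)"
  have x_bounds: "0 \<le> x \<omega>" "x \<omega> \<le> N" for \<omega>
    using N by (auto simp: x_def)
  have x_meas [measurable]: "x \<in> borel_measurable M"
    unfolding x_def by measurable
  have \<Phi>Y: "\<Phi> (Y \<omega>) = x \<omega>" for \<omega>
    using n by (simp add: \<Phi>_def Y_def x_def)
  have \<Psi>Y: "\<Psi> (Y \<omega>) = 1 - indicator A \<omega>" if "\<omega> \<in> space M" for \<omega>
    using that by (auto simp: \<Psi>_def Y_def A_def not_le split: split_indicator)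
  have int_x: "integrable M x"
    by (rule integrable_const_bound[of _ N]) (use x_bounds in auto)
  have int_A: "integrable M (indicator A :: 'a \<Rightarrow> real)"
    by (simp add: emeasure_eq_measure)
  have int_xA: "integrable M (\<lambda>\<omega>. x \<omega> * indicator A \<omega>)"
    by (rule integrable_const_bound[of _ N])
      (use x_bounds N in \<open>auto split: split_indicator\<close>)
  have "comonotony_principle M n Y"
    using princ n t unfolding finite_dim_comonotony_principle_def Y_def by blast
  moreover have "integrable M (\<lambda>\<omega>. \<Psi> (Y \<omega>))"
    using int_A by (simp add: \<Psi>Y cong: Bochner_Integration.integrable_cong)
  moreover have "integrable M (\<lambda>\<omega>. x \<omega> * \<Psi> (Y \<omega>))"
    using int_x int_xA
    by (simp add: \<Psi>Y right_diff_distrib cong: Bochner_Integration.integrable_cong)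
  ultimately have
    "(\<integral>\<omega>. x \<omega> \<partial>M) * (\<integral>\<omega>. \<Psi> (Y \<omega>) \<partial>M) \<le> (\<integral>\<omega>. x \<omega> * \<Psi> (Y \<omega>) \<partial>M)"
    using \<Phi>_meas \<Psi>_meas comono int_x unfolding comonotony_principle_def
    by (auto simp: \<Phi>Y)
  moreover have "(\<integral>\<omega>. \<Psi> (Y \<omega>) \<partial>M) = 1 - prob A"
    using int_A by (simp add: \<Psi>Y prob_space cong: Bochner_Integration.integral_cong)
  moreover have "(\<integral>\<omega>. x \<omega> * \<Psi> (Y \<omega>) \<partial>M) = (\<integral>\<omega>. x \<omega> \<partial>M) - (\<integral>\<omega>. x \<omega> * indicator A \<omega> \<partial>M)"
    using int_x int_xA
    by (simp add: \<Psi>Y right_diff_distrib cong: Bochner_Integration.integral_cong)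
  \<comment> \<open>Substituting \<open>1 - indicator A\<close> for the second function, the term
    \<open>E x\<close> cancels from both sides and the inequality reverses.\<close>
  ultimately have "(\<integral>\<omega>. x \<omega> * indicator A \<omega> \<partial>M) \<le> (\<integral>\<omega>. x \<omega> \<partial>M) * prob A"
    by (simp add: algebra_simps)
  then have "ennreal (\<integral>\<omega>. x \<omega> * indicator A \<omega> \<partial>M) \<le> ennreal (\<integral>\<omega>. x \<omega> \<partial>M) * ennreal (prob A)"
    using x_bounds by (simp add: ennreal_leI flip: ennreal_mult)
  moreover have "(\<integral>\<^sup>+\<omega>. X \<omega> \<partial>M) = ennreal (\<integral>\<omega>. x \<omega> \<partial>M)"
    using nn_integral_eq_integral[OF int_x] x_bounds by (simp add: X_def x_def)
  moreover have "(\<integral>\<^sup>+\<omega>. X \<omega> * indicator A \<omega> \<partial>M) = ennreal (\<integral>\<omega>. x \<omega> * indicator A \<omega> \<partial>M)"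
  proof -
    have "(\<integral>\<^sup>+\<omega>. X \<omega> * indicator A \<omega> \<partial>M) = (\<integral>\<^sup>+\<omega>. ennreal (x \<omega> * indicator A \<omega>) \<partial>M)"
      by (intro nn_integral_cong) (simp add: X_def x_def split: split_indicator)
    also have "\<dots> = ennreal (\<integral>\<omega>. x \<omega> * indicator A \<omega> \<partial>M)"
      by (rule nn_integral_eq_integral[OF int_xA]) (use x_bounds in auto)
    finally show ?thesis .
  qed
  ultimately show ?thesis
    by (simp add: emeasure_eq_measure)
qed

text \<open>Once the mesh \<open>T / 2 ^ m\<close> is below \<open>b - a\<close>, the first grid
  point strictly to the right of \<open>a\<close> exceeds \<open>a\<close> by at most one mesh, so
  it stays below \<open>b\<close>.\<close>

lemma dyadic_between:
  fixes T a b :: real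
  assumes "0 \<le> a" "a < b" "b \<le> T"
  shows "\<exists>m. \<exists>j\<le>2 ^ m. a < real j * T / 2 ^ m \<and> real j * T / 2 ^ m < b"
proof -
  have T: "T > 0" using assms by simp
  obtain m where m: "(1/2) ^ m < (b - a) / T"
    using real_arch_pow_inv[of "(b - a) / T" "1/2"] assms T by auto
  \<comment> \<open>Floor plus one, not the ceiling: the inequality with \<open>a\<close> must be
    strict even when \<open>a\<close> is itself a grid point.\<close>
  define j where "j = nat \<lfloor>a * 2 ^ m / T\<rfloor> + 1"
  have "0 \<le> a * 2 ^ m / T" using assms T by simp
  then have j: "a * 2 ^ m / T < real j" "real j \<le> a * 2 ^ m / T + 1"
    unfolding j_def by linarith+
  have lower: "a < real j * T / 2 ^ m"
    using j(1) T by (simp add: field_simps)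
  have "real j * T / 2 ^ m \<le> (a * 2 ^ m / T + 1) * T / 2 ^ m"
    using j(2) T by (intro divide_right_mono mult_right_mono) auto
  also have "\<dots> = a + T * (1/2) ^ m"
    using T by (simp add: field_simps)
  also have "\<dots> < b"
    using m T by (simp add: field_simps)
  finally have upper: "real j * T / 2 ^ m < b" .
  have "real j * T / 2 ^ m < T" using upper assms(3) by linarith
  then have "real j * T < 2 ^ m * T" by (simp add: field_simps)
  with T have "real j < real (2 ^ m)" by simp
  then have "j \<le> 2 ^ m" by linarith
  with lower upper show ?thesis by blast
qed

text \<open>By right-continuity a strict dip at \<open>s < T\<close> persists on an interval to the
  right of \<open>s\<close>, which contains dyadic times; the endpoint \<open>T\<close> belongs to
  every grid. An uncountable union over times thus becomes a countable one.\<close>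

lemma cadlag_dips_below_iff_dyadic:
  assumes "T > 0" "cadlag_on T x"
  shows "(\<exists>s\<in>{0..T}. x s < c) \<longleftrightarrow> (\<exists>m. \<exists>j\<le>2 ^ m. x (real j * T / 2 ^ m) < c)"
proof
  assume "\<exists>s\<in>{0..T}. x s < c"
  then obtain s where s: "s \<in> {0..T}" "x s < c" by blast
  show "\<exists>m. \<exists>j\<le>2 ^ m. x (real j * T / 2 ^ m) < c"
  proof (cases "s = T")
    case True
    with s show ?thesis by (intro exI[of _ 0] exI[of _ 1]) simp
  next
    case False
    with s have sT: "s \<in> {0..<T}" by auto
    with assms have "(x \<longlongrightarrow> x s) (at_right s)" by (simp add: cadlag_on_def)
    then have "\<forall>\<^sub>F u in at_right s. x u < c"
      using s(2) by (rule order_tendstoD)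
    then obtain b where b: "b > s" "\<And>u. s < u \<Longrightarrow> u < b \<Longrightarrow> x u < c"
      unfolding eventually_at_right_field by blast
    \<comment> \<open>Capping at \<open>T\<close> keeps the dyadic time inside the interval where
      the process is controlled.\<close>
    obtain m j where "j \<le> 2 ^ m" "s < real j * T / 2 ^ m" "real j * T / 2 ^ m < min b T"
      using dyadic_between[of s "min b T" T] b(1) sT by auto
    with b(2) show ?thesis by auto
  qed
next
  assume "\<exists>m. \<exists>j\<le>2 ^ m. x (real j * T / 2 ^ m) < c"
  then obtain m j where mj: "j \<le> 2 ^ m" "x (real j * T / 2 ^ m) < c" by blast
  from mj(1) have "real j \<le> 2 ^ m" by (metis of_nat_le_iff of_nat_numeral of_nat_power)
  with assms have "real j * T / 2 ^ m \<in> {0..T}" by (simp add: field_simps)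
  with mj(2) show "\<exists>s\<in>{0..T}. x s < c" by blast
qed

text \<open>The barrier event is approached in two stages, because the infimum may equal
  \<open>L\<close> only as a left limit, with every grid value above \<open>L\<close>. Strict dips
  below a level \<open>c > L\<close> are seen by the grids, and then \<open>c\<close> decreases to
  \<open>L\<close>. Measurability of \<open>B\<close> comes out of the same representation.\<close>

lemma truncated_call_barrier:
  fixes S :: "real \<Rightarrow> 'a \<Rightarrow> real" and K L N :: real
  assumes M: "prob_space M" and T: "T > 0"
    and cadlag: "cadlag_process M T S"
    and nonneg: "\<And>s \<omega>. s \<in> {0..T} \<Longrightarrow> \<omega> \<in> space M \<Longrightarrow> S s \<omega> \<ge> 0"
    and princ: "finite_dim_comonotony_principle M T S"
    and N: "N \<ge> 0"
  defines "X \<equiv> \<lambda>\<omega>. ennreal (min (max (S T \<omega> - K) 0) N)"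
    and "B \<equiv> {\<omega>\<in>space M. running_inf T S \<omega> \<le> L}"
  shows "B \<in> sets M"
    and "(\<integral>\<^sup>+\<omega>. X \<omega> * indicator B \<omega> \<partial>M) \<le> (\<integral>\<^sup>+\<omega>. X \<omega> \<partial>M) * emeasure M B"
proof -
  interpret prob_space M by fact
  have meas: "S s \<in> borel_measurable M" if "s \<in> {0..T}" for s
    using cadlag that by (auto simp: cadlag_process_def)
  have [measurable]: "S T \<in> borel_measurable M"
    using meas T by simp
  have X_meas [measurable]: "X \<in> borel_measurable M"
    unfolding X_def by measurable
  \<comment> \<open>Writing the left-hand side as a measure of the event makes continuity from below
    and from above available for it.\<close>
  define \<nu> where "\<nu> = density M X"
  define a where "a = (\<integral>\<^sup>+\<omega>. X \<omega> \<partial>M)"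
  have [simp]: "sets \<nu> = sets M" by (simp add: \<nu>_def)
  have \<nu>: "emeasure \<nu> A = (\<integral>\<^sup>+\<omega>. X \<omega> * indicator A \<omega> \<partial>M)" if "A \<in> sets M" for A
    unfolding \<nu>_def using that by (simp add: emeasure_density)
  \<comment> \<open>Finiteness of \<open>a\<close>, due to the truncation, serves twice: continuity
    from above for \<nu>, and passing limits through multiplication by \<open>a\<close> in
    \<open>ennreal\<close>.\<close>
  have a_fin: "a < \<infinity>"
  proof -
    have "a \<le> (\<integral>\<^sup>+\<omega>. ennreal N \<partial>M)"
      unfolding a_def X_def by (intro nn_integral_mono ennreal_leI) simp
    also have "\<dots> < \<infinity>" by (simp add: emeasure_space_1)
    finally show ?thesis .
  qed
  have \<nu>_fin: "emeasure \<nu> A \<noteq> \<infinity>" if "A \<in> sets M" for A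
  proof -
    have "emeasure \<nu> A \<le> a"
      unfolding \<nu>[OF that] a_def by (intro nn_integral_mono) (simp split: split_indicator)
    with a_fin show ?thesis by (auto simp: top_unique)
  qed
  define G where "G = (\<lambda>c m. {\<omega>\<in>space M. \<exists>j\<le>2 ^ m. S (real j * T / 2 ^ m) \<omega> < c})"
  have grid_in: "real j * T / 2 ^ m \<in> {0..T}" if "j \<le> 2 ^ m" for j m :: nat
  proof -
    from that have "real j \<le> 2 ^ m" by (metis of_nat_le_iff of_nat_numeral of_nat_power)
    with T show ?thesis by (simp add: field_simps)
  qed
  have G: "G c m \<in> sets M" "emeasure \<nu> (G c m) \<le> a * emeasure M (G c m)" for c m
  proof -
    \<comment> \<open>The level \<open>m\<close> grid has \<open>2 ^ m + 1\<close> points because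
      both endpoints count. Coordinates are numbered from 1, hence the shift \<open>k - 1\<close>,
      and the last one is exactly the time \<open>T\<close> of the payoff.\<close>
    define n :: nat where "n = 2 ^ m + 1"
    define t where "t = (\<lambda>k. real (k - 1) * T / 2 ^ m)"
    have t: "strict_mono_on {1..n} t"
      using T by (intro strict_mono_onI) (auto simp: t_def divide_strict_right_mono)
    have t_in: "t ` {1..n} \<subseteq> {0..T}"
      unfolding t_def n_def by (rule image_subsetI, rule grid_in) auto
    have tn: "t n = T" by (simp add: t_def n_def)
    have "(\<exists>k\<in>{1..n}. P (t k)) \<longleftrightarrow> (\<exists>j\<le>2 ^ m. P (real j * T / 2 ^ m))" for P
    proof
      assume "\<exists>k\<in>{1..n}. P (t k)"
      then obtain k where "k \<in> {1..n}" "P (t k)" by blast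
      then show "\<exists>j\<le>2 ^ m. P (real j * T / 2 ^ m)"
        by (intro exI[of _ "k - 1"]) (auto simp: t_def n_def)
    next
      assume "\<exists>j\<le>2 ^ m. P (real j * T / 2 ^ m)"
      then obtain j where "j \<le> 2 ^ m" "P (real j * T / 2 ^ m)" by blast
      then show "\<exists>k\<in>{1..n}. P (t k)"
        by (intro bexI[of _ "Suc j"]) (auto simp: t_def n_def)
    qed
    from this[of "\<lambda>s. S s _ < c"] have G_eq: "G c m = {\<omega>\<in>space M. \<exists>k\<in>{1..n}. S (t k) \<omega> < c}"
      unfolding G_def by simp
    have [measurable]: "S (t k) \<in> borel_measurable M" if "k \<in> {1..n}" for k
      using that t_in meas by blast
    show G_sets: "G c m \<in> sets M"
      unfolding G_eq by measurable
    show "emeasure \<nu> (G c m) \<le> a * emeasure M (G c m)"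
      unfolding \<nu>[OF G_sets] a_def
      using grid_truncated_call_barrier[OF M meas princ _ t t_in N, of K c]
      unfolding tn G_eq X_def by (simp add: n_def)
  qed
  \<comment> \<open>The grids are nested: the point with index \<open>j\<close> reappears with index
    \<open>2 * j\<close> one level up.\<close>
  have "incseq (G c)" for c
  proof (intro incseq_SucI subsetI)
    fix m \<omega> assume "\<omega> \<in> G c m"
    then obtain j where j: "\<omega> \<in> space M" "j \<le> 2 ^ m" "S (real j * T / 2 ^ m) \<omega> < c"
      by (auto simp: G_def)
    moreover have "real (2 * j) * T / 2 ^ Suc m = real j * T / 2 ^ m" by simp
    moreover have "2 * j \<le> 2 ^ Suc m" using j(2) by simp
    ultimately show "\<omega> \<in> G c (Suc m)"
      unfolding G_def mem_Collect_eq by metis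
  qed
  define H where "H = (\<lambda>c. {\<omega>\<in>space M. running_inf T S \<omega> < c})"
  have H_eq: "H c = (\<Union>m. G c m)" for c
  proof -
    have "running_inf T S \<omega> < c \<longleftrightarrow> (\<exists>m. \<exists>j\<le>2 ^ m. S (real j * T / 2 ^ m) \<omega> < c)"
      if "\<omega> \<in> space M" for \<omega>
    proof -
      \<comment> \<open>Nonnegativity of the paths makes the real-valued \<open>INF\<close> a
        genuine infimum.\<close>
      have "bdd_below ((\<lambda>s. S s \<omega>) ` {0..T})"
        using nonneg that by (intro bdd_belowI2[of _ 0]) auto
      moreover have "{0..T} \<noteq> {}" using T by simp
      ultimately have "running_inf T S \<omega> < c \<longleftrightarrow> (\<exists>s\<in>{0..T}. S s \<omega> < c)"
        unfolding running_inf_def by (intro cINF_less_iff)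
      moreover have "cadlag_on T (\<lambda>s. S s \<omega>)"
        using cadlag that by (auto simp: cadlag_process_def)
      ultimately show ?thesis
        using cadlag_dips_below_iff_dyadic[OF T] by simp
    qed
    then show ?thesis by (auto simp: H_def G_def)
  qed
  have H: "H c \<in> sets M" "emeasure \<nu> (H c) \<le> a * emeasure M (H c)" for c
  proof -
    show "H c \<in> sets M"
      unfolding H_eq using G(1) by blast
    have "(\<lambda>m. emeasure \<nu> (G c m)) \<longlonglongrightarrow> emeasure \<nu> (H c)"
      unfolding H_eq using G(1) \<open>incseq (G c)\<close> by (intro Lim_emeasure_incseq) auto
    moreover have "(\<lambda>m. a * emeasure M (G c m)) \<longlonglongrightarrow> a * emeasure M (H c)"
      unfolding H_eq using G(1) \<open>incseq (G c)\<close> a_fin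
      by (intro ennreal_tendsto_cmult Lim_emeasure_incseq) auto
    ultimately show "emeasure \<nu> (H c) \<le> a * emeasure M (H c)"
      by (rule LIMSEQ_le) (use G(2) in auto)
  qed
  \<comment> \<open>The levels stay strictly above \<open>L\<close>, so intersecting the strict
    events yields the non-strict event \<open>B\<close>.\<close>
  define c where "c = (\<lambda>i. L + inverse (real (Suc i)))"
  have "decseq (\<lambda>i. H (c i))"
    by (intro decseq_SucI)
      (auto simp: H_def c_def elim!: less_le_trans intro!: le_imp_inverse_le)
  have B_eq: "B = (\<Inter>i. H (c i))"
  proof -
    have "u \<le> L \<longleftrightarrow> (\<forall>i. u < c i)" for u
    proof
      assume u: "\<forall>i. u < c i"
      have "c \<longlonglongrightarrow> L + 0"
        unfolding c_def by (intro tendsto_add tendsto_const LIMSEQ_inverse_real_of_nat)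
      then show "u \<le> L"
        using u by (intro LIMSEQ_le_const[of c]) (auto intro: less_imp_le)
    next
      assume "u \<le> L"
      show "\<forall>i. u < c i"
      proof
        fix i
        have "0 < inverse (real (Suc i))" by simp
        with \<open>u \<le> L\<close> show "u < c i" unfolding c_def by linarith
      qed
    qed
    then show ?thesis by (auto simp: B_def H_def)
  qed
  show B_sets: "B \<in> sets M"
    unfolding B_eq using H(1) by blast
  have "(\<lambda>i. emeasure \<nu> (H (c i))) \<longlonglongrightarrow> emeasure \<nu> B"
    unfolding B_eq using H(1) \<open>decseq (\<lambda>i. H (c i))\<close> \<nu>_fin
    by (intro Lim_emeasure_decseq) auto
  moreover have "(\<lambda>i. a * emeasure M (H (c i))) \<longlonglongrightarrow> a * emeasure M B"
    unfolding B_eq using H(1) \<open>decseq (\<lambda>i. H (c i))\<close> a_fin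
    by (intro ennreal_tendsto_cmult Lim_emeasure_decseq) auto
  ultimately have "emeasure \<nu> B \<le> a * emeasure M B"
    by (rule LIMSEQ_le) (use H(2) in auto)
  then show "(\<integral>\<^sup>+\<omega>. X \<omega> * indicator B \<omega> \<partial>M) \<le> (\<integral>\<^sup>+\<omega>. X \<omega> \<partial>M) * emeasure M B"
    by (simp add: \<nu>[OF B_sets] a_def)
qed

theorem proposition6p3:
  fixes M :: "'a measure" and S :: "real \<Rightarrow> 'a \<Rightarrow> real" and T K L :: real
  assumes "prob_space M"
    and "T > 0"
    and "cadlag_process M T S"
    and "\<forall>t\<in>{0..T}. \<forall>\<omega>\<in>space M. S t \<omega> \<ge> 0"
    and "finite_dim_comonotony_principle M T S"
    and "K > 0"
    and "0 < L"
    and "AE \<omega> in M. L < S 0 \<omega>"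
  shows "call_down_in_premium M S K L T
           \<le> call_premium M S K T * emeasure M {\<omega>\<in>space M. running_inf T S \<omega> \<le> L}"
proof -
  define B where "B = {\<omega>\<in>space M. running_inf T S \<omega> \<le> L}"
  define X where "X = (\<lambda>(N::nat) \<omega>. ennreal (min (max (S T \<omega> - K) 0) (real N)))"
  have trunc: "(\<integral>\<^sup>+\<omega>. X N \<omega> * indicator B \<omega> \<partial>M) \<le> (\<integral>\<^sup>+\<omega>. X N \<omega> \<partial>M) * emeasure M B" for N
    unfolding X_def B_def using assms by (intro truncated_call_barrier) auto
  \<comment> \<open>The event does not involve the truncation level, so any nonnegative value may be
    chosen.\<close>
  have [measurable]: "B \<in> sets M"
    unfolding B_def using assms by (intro truncated_call_barrier(1)[where N = 0]) auto
  have [measurable]: "S T \<in> borel_measurable M"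
    using assms by (auto simp: cadlag_process_def)
  have [measurable]: "X N \<in> borel_measurable M" for N
    unfolding X_def by measurable
  have X_mono: "incseq (\<lambda>N. X N \<omega> * indicator B \<omega>)" for \<omega>
    unfolding X_def
    by (intro incseq_SucI mult_right_mono ennreal_leI min.mono) auto
  \<comment> \<open>For each outcome the supremum is attained as soon as \<open>N\<close> exceeds
    the untruncated payoff.\<close>
  have X_sup: "(SUP N. X N \<omega> * indicator B \<omega>) = ennreal (max (S T \<omega> - K) 0) * indicator B \<omega>" for \<omega>
  proof (rule antisym)
    show "(SUP N. X N \<omega> * indicator B \<omega>) \<le> ennreal (max (S T \<omega> - K) 0) * indicator B \<omega>"
      unfolding X_def by (intro SUP_least mult_right_mono ennreal_leI) auto
    obtain N :: nat where "max (S T \<omega> - K) 0 \<le> real N"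
      using real_arch_simple by blast
    then have "ennreal (max (S T \<omega> - K) 0) = X N \<omega>" by (simp add: X_def min_absorb1)
    then show "ennreal (max (S T \<omega> - K) 0) * indicator B \<omega> \<le> (SUP N. X N \<omega> * indicator B \<omega>)"
      by (auto intro: SUP_upper)
  qed
  have "call_down_in_premium M S K L T = (\<integral>\<^sup>+\<omega>. (SUP N. X N \<omega> * indicator B \<omega>) \<partial>M)"
    unfolding call_down_in_premium_def X_sup
    by (intro nn_integral_cong) (auto simp: B_def split: split_indicator)
  also have "\<dots> = (SUP N. \<integral>\<^sup>+\<omega>. X N \<omega> * indicator B \<omega> \<partial>M)"
    using X_mono
    by (intro nn_integral_monotone_convergence_SUP) (auto simp: incseq_def le_fun_def)
  \<comment> \<open>Monotone convergence is applied on the left only. On the right each truncated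
    premium is bounded by the full one, which also covers an infinite premium, with
    \<open>\<infinity> * 0 = 0\<close> if the barrier event is null.\<close>
  also have "\<dots> \<le> call_premium M S K T * emeasure M B"
  proof (rule SUP_least)
    fix N
    have "(\<integral>\<^sup>+\<omega>. X N \<omega> \<partial>M) \<le> call_premium M S K T"
      unfolding call_premium_def X_def by (intro nn_integral_mono ennreal_leI) simp
    then show "(\<integral>\<^sup>+\<omega>. X N \<omega> * indicator B \<omega> \<partial>M) \<le> call_premium M S K T * emeasure M B"
      using trunc[of N] by (blast intro: order_trans mult_right_mono zero_le)
  qed
  finally show ?thesis
    unfolding B_def .
qed

end
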